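(* Let $\epsilon>0$ and $c_0\in\mathbb{R}$. Let $\phi,c:\mathbb{R}\to\mathbb{R}$ be twice differentiable functions satisfying on $\mathbb{R}$ the equations $$ \frac{d^2 \phi}{d x^2} - \frac{1}{\epsilon} \frac{d}{dx}\big\{(1-\phi)\phi\big\} = 0, \qquad \frac{d^2 c}{d x^2} - \frac{1}{\epsilon} \frac{d}{dx}\big\{(1-\phi)c\big\} = 0, $$ with the boundary conditions $\phi(x)\to 0$ as $x\to-\infty$, $\phi(0)=\tfrac12$, $c(x)\to 0$ as $x\to-\infty$, and $c(0)=c_0$. Then for all $x\in\mathbb{R}$ $$ \phi(x) = \frac{e^{x/\epsilon}}{1 + e^{x/\epsilon}} = \frac{1}{2} \left\{1 + \tanh\left(\frac{x}{2\epsilon}\right)\right\}, \qquad c(x) = 2c_0\frac{e^{x/\epsilon}}{1 + e^{x/\epsilon}} = c_0 \left\{1 + \tanh\left(\frac{x}{2\epsilon}\right)\right\}, $$ and consequently the ratio $\tilde c=c/\phi$ is constant, equal to $2c_0$.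
   Context: The two equations are the one-dimensional steady-state forms, with zero fluid velocity, zero relative scalar velocity, and interface normal $n=+1$, of the phase-field equation $\partial_t\phi+\nabla\cdot(u\phi)=\nabla\cdot[\Gamma\{\epsilon\nabla\phi-\phi(1-\phi)n\}]$ and the scalar-transport model $\partial_t c+\nabla\cdot(uc+\phi u_r c)=\nabla\cdot[D\{\nabla c-(1-\phi)nc/\epsilon\}]$, with constants $\Gamma,D>0$. Here $\phi$ is the volume fraction, $c$ the scalar concentration per unit total volume, $\tilde c=c/\phi$ the concentration per unit volume of the phase, $\epsilon$ the interface thickness parameter. *)

theory Defs
  imports "HOL-Analysis.Analysis"
begin

end

(* Each equation integrates once; the decay at minus infinity forces the constant of
   integration to vanish, leaving the first-order equations phi' = (1 - phi) phi / eps and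
   c' = (1 - phi) c / eps.  With E = exp (x / eps), both phi (1 + E) - E and c - 2 c0 phi solve
   the linear equation y' = (1 - phi) y / eps and vanish at 0, hence vanish identically. *)
theory Submission
  imports Defs
begin

lemma continuous_on_UNIV_antiderivative:
  fixes a :: "real \<Rightarrow> real"
  assumes "continuous_on UNIV a"
  obtains A where "\<And>x. (A has_real_derivative a x) (at x)"
proof -
  \<comment> \<open>The whole line is treated as the open interval with infinite endpoints, so a
    single antiderivative serves at every real point.\<close>
  have "\<exists>A. \<forall>x. -\<infinity> < ereal x \<longrightarrow> ereal x < \<infinity> \<longrightarrow> (A has_vector_derivative a x) (at x)"
    using assms by (intro einterval_antiderivative) (auto simp: continuous_on_eq_continuous_at)
  then show ?thesis
    using that by (auto simp: has_real_derivative_iff_has_vector_derivative)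
qed

text \<open>Integrating factor: if \<open>A\<close> is an antiderivative of \<open>a\<close>, then
  \<open>y x * exp (- A x)\<close> has derivative 0, so it keeps its value 0 from \<open>t\<close>,
  and the exponential factor never vanishes.\<close>

lemma linear_ode_vanishes:
  fixes y a :: "real \<Rightarrow> real"
  assumes "continuous_on UNIV a"
    and y: "\<And>x. (y has_real_derivative a x * y x) (at x)"
    and "y t = 0"
  shows "y x = 0"
proof -
  obtain A where A: "\<And>x. (A has_real_derivative a x) (at x)"
    using continuous_on_UNIV_antiderivative[OF assms(1)] by blast
  have "((\<lambda>x. y x * exp (- A x)) has_real_derivative 0) (at x)" for x
    by (rule derivative_eq_intros y A refl)+ (simp add: algebra_simps)
  then have "y x * exp (- A x) = y t * exp (- A t)"
    by (intro DERIV_isconst_all) auto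
  then show ?thesis
    using \<open>y t = 0\<close> by simp
qed

text \<open>By the mean value theorem on \<open>[x - 1, x]\<close>, the increment of
  \<open>f\<close> is \<open>f'\<close> at some \<open>z x < x\<close>. As \<open>x\<close> goes to
  minus infinity the increment tends to \<open>l - l = 0\<close>, while \<open>f' (z x)\<close>
  tends to \<open>K\<close>.\<close>

lemma derivative_limit_at_bot_eq_0:
  fixes f f' :: "real \<Rightarrow> real"
  assumes der: "\<And>x. (f has_real_derivative f' x) (at x)"
    and f: "(f \<longlongrightarrow> l) at_bot" and f': "(f' \<longlongrightarrow> K) at_bot"
  shows "K = 0"
proof -
  have "\<exists>z. x - 1 < z \<and> z < x \<and> f x - f (x - 1) = f' z" for x
    using MVT2[of "x - 1" x f f'] der by auto
  then obtain z where z: "\<And>x. x - 1 < z x \<and> z x < x \<and> f x - f (x - 1) = f' (z x)"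
    by metis
  have "filterlim z at_bot at_bot"
    by (rule filterlim_at_bot_mono[OF filterlim_ident]) (use z in \<open>auto intro: always_eventually less_imp_le\<close>)
  then have "((\<lambda>x. f' (z x)) \<longlongrightarrow> K) at_bot"
    by (rule filterlim_compose[OF f'])
  moreover have "filterlim (\<lambda>x::real. x - 1) at_bot at_bot"
    by (rule filterlim_at_bot_mono[OF filterlim_ident]) auto
  then have "((\<lambda>x. f x - f (x - 1)) \<longlongrightarrow> l - l) at_bot"
    by (intro tendsto_diff f filterlim_compose[OF f])
  ultimately show ?thesis
    using z tendsto_unique[of at_bot "\<lambda>x. f' (z x)" K 0] by simp
qed

text \<open>The equation makes \<open>deriv u - g / \<epsilon>\<close> a constant \<open>K\<close>.
  Since \<open>g\<close> decays, \<open>deriv u\<close> tends to \<open>K\<close>, and convergence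
  of \<open>u\<close> forces \<open>K = 0\<close>. Keeping \<open>g\<close> general covers both the
  phase-field and the scalar equation.\<close>

lemma steady_state_first_integral:
  fixes \<epsilon> :: real and u g :: "real \<Rightarrow> real"
  assumes u: "u differentiable_on UNIV" and u': "deriv u differentiable_on UNIV"
    and g: "g differentiable_on UNIV"
    and eq: "\<And>x. deriv (deriv u) x - 1 / \<epsilon> * deriv g x = 0"
    and "(u \<longlongrightarrow> l) at_bot" and g0: "(g \<longlongrightarrow> 0) at_bot"
  shows "(u has_real_derivative g x / \<epsilon>) (at x)"
proof -
  have D: "(h has_real_derivative deriv h x) (at x)" if "h differentiable_on UNIV" for h x
    using that by (auto simp: differentiable_on_def DERIV_deriv_iff_real_differentiable)
  have "((\<lambda>x. deriv u x - 1 / \<epsilon> * g x) has_real_derivative 0) (at x)" for x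
    using DERIV_diff[OF D[OF u', of x] DERIV_cmult[OF D[OF g, of x], of "1 / \<epsilon>"]] eq[of x] by simp
  then have "deriv u x - 1 / \<epsilon> * g x = deriv u 0 - 1 / \<epsilon> * g 0" for x
    by (intro DERIV_isconst_all) auto
  then obtain K where K: "\<And>x. deriv u x = K + 1 / \<epsilon> * g x"
    by (metis diff_add_cancel)
  have "((\<lambda>x. K + 1 / \<epsilon> * g x) \<longlongrightarrow> K + 1 / \<epsilon> * 0) at_bot"
    by (intro tendsto_intros g0)
  then have "(deriv u \<longlongrightarrow> K) at_bot"
    by (simp add: K[abs_def])
  then have "K = 0"
    using derivative_limit_at_bot_eq_0[OF D[OF u] assms(5)] by simp
  then show ?thesis
    using D[OF u, of x] K by simp
qed

lemma logistic_eq_tanh: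
  fixes y :: real
  shows "exp y / (1 + exp y) = 1 / 2 * (1 + tanh (y / 2))"
proof -
  \<comment> \<open>These are denominators that arise once \<open>exp (- y)\<close> is rewritten as
    an inverse; their positivity allows clearing them.\<close>
  have "1 + exp y > 0" "exp y + exp y * exp y > 0"
    by (simp_all add: add_pos_pos)
  then show ?thesis
    by (simp add: tanh_real_altdef exp_minus field_simps)
qed

theorem mainTheorem2:
  fixes \<epsilon> c\<^sub>0 :: real and \<phi> c :: "real \<Rightarrow> real"
  assumes "\<epsilon> > 0"
    and "\<phi> differentiable_on UNIV" and "deriv \<phi> differentiable_on UNIV"
    and "c differentiable_on UNIV" and "deriv c differentiable_on UNIV"
    and "\<And>x. deriv (deriv \<phi>) x - 1 / \<epsilon> * deriv (\<lambda>y. (1 - \<phi> y) * \<phi> y) x = 0"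
    and "\<And>x. deriv (deriv c) x - 1 / \<epsilon> * deriv (\<lambda>y. (1 - \<phi> y) * c y) x = 0"
    and "(\<phi> \<longlongrightarrow> 0) at_bot" and "\<phi> 0 = 1 / 2"
    and "(c \<longlongrightarrow> 0) at_bot" and "c 0 = c\<^sub>0"
  shows "(\<forall>x. \<phi> x = exp (x / \<epsilon>) / (1 + exp (x / \<epsilon>)) \<and>
              exp (x / \<epsilon>) / (1 + exp (x / \<epsilon>)) = 1 / 2 * (1 + tanh (x / (2 * \<epsilon>))) \<and>
              c x = 2 * c\<^sub>0 * (exp (x / \<epsilon>) / (1 + exp (x / \<epsilon>))) \<and>
              2 * c\<^sub>0 * (exp (x / \<epsilon>) / (1 + exp (x / \<epsilon>))) = c\<^sub>0 * (1 + tanh (x / (2 * \<epsilon>)))) \<and>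
         (\<forall>x. \<phi> x \<noteq> 0 \<and> c x / \<phi> x = 2 * c\<^sub>0)"
proof -
  have lim_1_minus: "((\<lambda>x. (1 - \<phi> x) * h x) \<longlongrightarrow> 0) at_bot" if "(h \<longlongrightarrow> 0) at_bot" for h
    using tendsto_mult[OF tendsto_diff[OF tendsto_const[of 1] assms(8)] that] by simp
  have \<phi>: "(\<phi> has_real_derivative (1 - \<phi> x) * \<phi> x / \<epsilon>) (at x)" for x
    by (rule steady_state_first_integral[OF assms(2,3) _ assms(6,8) lim_1_minus[OF assms(8)]])
      (intro derivative_intros assms(2))
  have c: "(c has_real_derivative (1 - \<phi> x) * c x / \<epsilon>) (at x)" for x
    by (rule steady_state_first_integral[OF assms(4,5) _ assms(7,10) lim_1_minus[OF assms(10)]])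
      (intro derivative_intros assms(2,4))+
  \<comment> \<open>With \<open>\<phi>\<close> regarded as known, this is the common coefficient of
    both first-order equations, which makes even the quadratic one for \<open>\<phi>\<close>
    linear.\<close>
  have cont: "continuous_on UNIV (\<lambda>x. (1 - \<phi> x) / \<epsilon>)"
    using \<open>\<epsilon> > 0\<close> differentiable_imp_continuous_on[OF assms(2)]
    by (intro continuous_intros) auto
  \<comment> \<open>With \<open>E = exp (x / \<epsilon>)\<close>, differentiating the two
    occurrences of \<open>E\<close> gives \<open>(\<phi> - 1) * E / \<epsilon>\<close>, which
    supplies exactly the \<open>- E\<close> term on the right.\<close>
  have "((\<lambda>x. \<phi> x * (1 + exp (x / \<epsilon>)) - exp (x / \<epsilon>)) has_real_derivative
      (1 - \<phi> x) / \<epsilon> * (\<phi> x * (1 + exp (x / \<epsilon>)) - exp (x / \<epsilon>))) (at x)" for x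
    using \<open>\<epsilon> > 0\<close> by (auto intro!: derivative_eq_intros \<phi> simp: field_simps)
  then have \<phi>_zero: "\<phi> x * (1 + exp (x / \<epsilon>)) - exp (x / \<epsilon>) = 0" for x
    by (rule linear_ode_vanishes[OF cont, where t = 0]) (simp add: assms(9))
  have \<phi>_eq: "\<phi> x = exp (x / \<epsilon>) / (1 + exp (x / \<epsilon>))" for x
    using \<phi>_zero[of x] by (simp add: field_simps add_pos_pos less_imp_neq[THEN not_sym])
  \<comment> \<open>Both \<open>c\<close> and \<open>\<phi>\<close> solve the same linear equation;
    the factor \<open>2 * c\<^sub>0\<close> matches their values at 0, where \<open>\<phi>\<close>
    is \<open>1 / 2\<close>.\<close>
  have "((\<lambda>x. c x - 2 * c\<^sub>0 * \<phi> x) has_real_derivative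
      (1 - \<phi> x) / \<epsilon> * (c x - 2 * c\<^sub>0 * \<phi> x)) (at x)" for x
    using \<open>\<epsilon> > 0\<close> by (auto intro!: derivative_eq_intros \<phi> c simp: field_simps)
  then have "c x - 2 * c\<^sub>0 * \<phi> x = 0" for x
    by (rule linear_ode_vanishes[OF cont, where t = 0]) (simp add: assms(9,11))
  then have c_eq: "c x = 2 * c\<^sub>0 * \<phi> x" for x
    by (metis right_minus_eq)
  have logistic: "exp (x / \<epsilon>) / (1 + exp (x / \<epsilon>)) = 1 / 2 * (1 + tanh (x / (2 * \<epsilon>)))" for x
    using logistic_eq_tanh[of "x / \<epsilon>"] by (simp add: mult.commute)
  have "\<phi> x \<noteq> 0" for x
    using exp_gt_zero[of "x / \<epsilon>"] by (simp add: \<phi>_eq add_nonneg_eq_0_iff)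
  then show ?thesis
    using c_eq \<phi>_eq unfolding \<phi>_eq logistic by simp
qed

end
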